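(* Let $(A,[\cdot,\cdot],\delta_A,\alpha_A)$ be a Hom-Lie bialgebra, $(E,\alpha_E)$ a Hom-vector space containing $(A,\alpha_A)$ as a subspace, and $(V,\alpha_V)$ a complement of $(A,\alpha_A)$ in $(E,\alpha_E)$. Put $\mathcal{HLB}(V,A):=\big(\mathcal{LB}^{(1)}(A,V)\sqcup\mathcal{LB}^{(2)}(A,V)\big)/\equiv$. Then the map $$\Upsilon:\mathcal{HLB}(V,A)\to BExtd(E,A),\qquad \overline{\Omega^{(1)}(A,V)}\mapsto A^{\phi,P}_{\theta}\#^{\psi}_{\triangleleft}V,\quad \overline{\Omega^{(2)}(A,V)}\mapsto A_{\triangleright}\#^{\psi,Q}_{\triangleleft,\sigma}V$$ (sending the class of a datum to the equivalence class of its unified product) is bijective, where $\overline{\Omega^{(i)}(A,V)}$ denotes the equivalence class of $\Omega^{(i)}(A,V)$ under $\equiv$.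
   Context: All vector spaces are over an algebraically closed field $k$ of characteristic different from 2 and 3. A Hom-vector space $(V,\alpha_V)$ is a vector space with a linear map $\alpha_V:V\to V$. "$(E,\alpha_E)$ contains $(A,\alpha_A)$ with complement $(V,\alpha_V)$" means $E=A\oplus V$ and $\alpha_E=\alpha_A\oplus\alpha_V$; $i:A\to E$ is the inclusion and $p:E\to A$ the projection along $V$. $\tau(x\otimes y)=y\otimes x$, $\tau_{12}(x\otimes y\otimes z)=y\otimes x\otimes z$. A Hom-Lie algebra $(H,[\cdot,\cdot],\alpha_H)$: skew-symmetric bilinear bracket with $[\alpha_H(x),[y,z]]+[\alpha_H(y),[z,x]]+[\alpha_H(z),[x,y]]=0$. A Hom-Lie coalgebra $(H,\delta,\alpha_H)$: $\delta=-\tau\delta$ and $(\alpha_H\otimes\delta)\delta=(\delta\otimes\alpha_H)\delta+\tau_{12}(\alpha_H\otimes\delta)\delta$. A Hom-Lie bialgebra is both at once, with $\delta([x,y])=[\alpha_H(x),\delta(y)]+[\delta(x),\alpha_H(y)]$, where $[z,u_1\otimes u_2]:=[z,u_1]\otimes\alpha_H(u_2)+\alpha_H(u_1)\otimes[z,u_2]$ and $[u_1\otimes u_2,z]:=[u_1,z]\otimes\alpha_H(u_2)+\alpha_H(u_1)\otimes[u_2,z]$. A homomorphism of Hom-Lie bialgebras is a linear map commuting with the structure maps $\alpha$, the brackets and the cobrackets. $BExtd(E,A)$: the set of equivalence classes of Hom-Lie bialgebra structures on $(E,\alpha_E)$ (with twisting map $\alpha_E$) for which $i:A\to E$ or $p:E\to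 A$ is a Hom-Lie bialgebra homomorphism; two such structures are equivalent if there is a Hom-Lie bialgebra isomorphism $\varphi$ between them with $\varphi(a)=a$ for all $a\in A$. $\mathcal{LB}^{(1)}(A,V)$ (extending data of type (I)): the set of tuples $\Omega^{(1)}(A,V)=(\triangleleft,\theta,\phi,\psi,P,[\cdot,\cdot]_V,\delta_V)$ of linear maps $\triangleleft:V\otimes A\to V$, $\theta:A\otimes A\to V$, $[\cdot,\cdot]_V:V\otimes V\to V$, $\phi:A\to V\otimes A$, $\psi:V\to V\otimes A$, $P:A\to V\otimes V$, $\delta_V:V\to V\otimes V$ such that the unified product $A^{\phi,P}_{\theta}\#^{\psi}_{\triangleleft}V$, i.e. $E=A\oplus V$ with $\alpha_E$, bracket $[(a,x),(b,y)]=([a,b],\,[x,y]_V+x\triangleleft b-y\triangleleft a+\theta(a,b))$ and cobracket $\delta_E(a)=\delta_A(a)+\phi(a)-\tau\phi(a)+P(a)$, $\delta_E(x)=\delta_V(x)+\psi(x)-\tau\psi(x)$, is a Hom-Lie bialgebra. $\mathcal{LB}^{(2)}(A,V)$ (extending data of type (II)): the set of tuples $\Omega^{(2)}(A,V)=(\triangleright,\triangleleft,\sigma,\psi,Q,[\cdot,\cdot]_V,\delta_V)$ of linear maps $\triangleright:V\otimes A\to A$, $\triangleleft:V\otimes A\to V$, $\sigma:V\otimes V\to A$, $[\cdot,\cdot]_V:V\otimes V\to V$, $\psi:V\to V\otimes A$, $Q:V\to A\otimes A$, $\delta_V:V\to V\otimes V$ such that the unified product $A_{\triangleright}\#^{\psi,Q}_{\triangleleft,\sigma}V$,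 i.e. $E=A\oplus V$ with $\alpha_E$, bracket $[(a,x),(b,y)]=([a,b]+x\triangleright b-y\triangleright a+\sigma(x,y),\,[x,y]_V+x\triangleleft b-y\triangleleft a)$ and cobracket $\delta_E(a)=\delta_A(a)$, $\delta_E(x)=\delta_V(x)+\psi(x)-\tau\psi(x)+Q(x)$, is a Hom-Lie bialgebra. Equivalence $\equiv$ of data: $\Omega\equiv\Omega'$ if there are linear maps $r:V\to A$, $s:V\to V$ such that $\varphi_{r,s}(a,x)=(a+r(x),s(x))$ is an isomorphism of Hom-Lie bialgebras between the corresponding unified products. *)

theory Defs
  imports "HOL-Computational_Algebra.Polynomial" "HOL-Library.Function_Algebras"
begin

section \<open>Tensor products of vector spaces\<close>

text \<open>
  Over a field, \<open>V \<otimes> W\<close> embeds canonically into the bilinear forms on \<open>V* \<times> W*\<close> by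
  \<open>v \<otimes> w \<mapsto> (\<lambda>f g. f v * g w)\<close>. We take the span of these pure tensors as the tensor product.
  To have one function per tensor, all tensors are \<open>0\<close> on arguments that are not
  linear functionals. That this is the tensor product (in any dimension) is shown by the
  universal property \<open>tensor_universal\<close> below.
\<close>

type_synonym ('a, 'b, 'k) ten = "('a \<Rightarrow> 'k) \<Rightarrow> ('b \<Rightarrow> 'k) \<Rightarrow> 'k"
type_synonym ('a, 'b, 'c, 'k) ten3 = "('a \<Rightarrow> 'k) \<Rightarrow> ('b \<Rightarrow> 'k) \<Rightarrow> ('c \<Rightarrow> 'k) \<Rightarrow> 'k"

definition dual :: "('k::field \<Rightarrow> 'a::ab_group_add \<Rightarrow> 'a) \<Rightarrow> ('a \<Rightarrow> 'k) set" where
  "dual s = {f. Vector_Spaces.linear s (*) f}"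

definition tscale :: "'k::field \<Rightarrow> ('a, 'b, 'k) ten \<Rightarrow> ('a, 'b, 'k) ten" where
  "tscale c t = (\<lambda>f g. c * t f g)"

definition tensor :: "('k::field \<Rightarrow> 'a::ab_group_add \<Rightarrow> 'a) \<Rightarrow> ('k \<Rightarrow> 'b::ab_group_add \<Rightarrow> 'b)
    \<Rightarrow> 'a \<Rightarrow> 'b \<Rightarrow> ('a, 'b, 'k) ten" where
  "tensor s1 s2 x y = (\<lambda>f g. if f \<in> dual s1 \<and> g \<in> dual s2 then f x * g y else 0)"

definition tensor_space :: "('k::field \<Rightarrow> 'a::ab_group_add \<Rightarrow> 'a)
    \<Rightarrow> ('k \<Rightarrow> 'b::ab_group_add \<Rightarrow> 'b) \<Rightarrow> ('a, 'b, 'k) ten set" where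
  "tensor_space s1 s2 = module.span tscale {tensor s1 s2 x y |x y. True}"

definition tensor3 :: "('k::field \<Rightarrow> 'a::ab_group_add \<Rightarrow> 'a) \<Rightarrow> ('k \<Rightarrow> 'b::ab_group_add \<Rightarrow> 'b)
    \<Rightarrow> ('k \<Rightarrow> 'c::ab_group_add \<Rightarrow> 'c) \<Rightarrow> 'a \<Rightarrow> 'b \<Rightarrow> 'c \<Rightarrow> ('a, 'b, 'c, 'k) ten3" where
  "tensor3 s1 s2 s3 x y z =
     (\<lambda>f g h. if f \<in> dual s1 \<and> g \<in> dual s2 \<and> h \<in> dual s3 then f x * g y * h z else 0)"

text \<open>
  The operations on tensors are given by pulling back functionals; \<open>tmap_tensor\<close>,
  \<open>tswap_tensor\<close>, \<open>tmap_left_tensor\<close>, \<open>tmap_right_tensor\<close>, \<open>tswap12_tensor3\<close> show what they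
  do to pure tensors. The scalar multiplications passed to the maps are those of the targets.
\<close>

definition tswap :: "('a, 'b, 'k) ten \<Rightarrow> ('b, 'a, 'k) ten" where
  "tswap t = (\<lambda>g f. t f g)"

definition tswap12 :: "('a, 'b, 'c, 'k) ten3 \<Rightarrow> ('b, 'a, 'c, 'k) ten3" where
  "tswap12 t = (\<lambda>g f h. t f g h)"

definition tmap :: "('k::field \<Rightarrow> 'c::ab_group_add \<Rightarrow> 'c) \<Rightarrow> ('k \<Rightarrow> 'd::ab_group_add \<Rightarrow> 'd)
    \<Rightarrow> ('a \<Rightarrow> 'c) \<Rightarrow> ('b \<Rightarrow> 'd) \<Rightarrow> ('a, 'b, 'k) ten \<Rightarrow> ('c, 'd, 'k) ten" where
  "tmap s1 s2 F G t = (\<lambda>f g. if f \<in> dual s1 \<and> g \<in> dual s2 then t (f \<circ> F) (g \<circ> G) else 0)"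

text \<open>\<open>tmap_left s F D\<close> is \<open>F \<otimes> D\<close> and \<open>tmap_right s D F\<close> is \<open>D \<otimes> F\<close> for \<open>F : V \<rightarrow> V\<close>
  and \<open>D : V \<rightarrow> V \<otimes> V\<close>, with values in \<open>V \<otimes> V \<otimes> V\<close>.\<close>

definition tmap_left :: "('k::field \<Rightarrow> 'a::ab_group_add \<Rightarrow> 'a) \<Rightarrow> ('a \<Rightarrow> 'a)
    \<Rightarrow> ('a \<Rightarrow> ('a, 'a, 'k) ten) \<Rightarrow> ('a, 'a, 'k) ten \<Rightarrow> ('a, 'a, 'a, 'k) ten3" where
  "tmap_left s F D t = (\<lambda>f g h.
     if f \<in> dual s \<and> g \<in> dual s \<and> h \<in> dual s then t (f \<circ> F) (\<lambda>y. D y g h) else 0)"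

definition tmap_right :: "('k::field \<Rightarrow> 'a::ab_group_add \<Rightarrow> 'a) \<Rightarrow> ('a \<Rightarrow> ('a, 'a, 'k) ten)
    \<Rightarrow> ('a \<Rightarrow> 'a) \<Rightarrow> ('a, 'a, 'k) ten \<Rightarrow> ('a, 'a, 'a, 'k) ten3" where
  "tmap_right s D F t = (\<lambda>f g h.
     if f \<in> dual s \<and> g \<in> dual s \<and> h \<in> dual s then t (\<lambda>x. D x f g) (h \<circ> F) else 0)"

definition bilinear_map :: "('k::field \<Rightarrow> 'a::ab_group_add \<Rightarrow> 'a)
    \<Rightarrow> ('k \<Rightarrow> 'b::ab_group_add \<Rightarrow> 'b) \<Rightarrow> ('k \<Rightarrow> 'c::ab_group_add \<Rightarrow> 'c)
    \<Rightarrow> ('a \<Rightarrow> 'b \<Rightarrow> 'c) \<Rightarrow> bool" where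
  "bilinear_map s1 s2 s3 b \<longleftrightarrow>
     (\<forall>x. Vector_Spaces.linear s2 s3 (b x)) \<and> (\<forall>y. Vector_Spaces.linear s1 s3 (\<lambda>x. b x y))"

definition linear_to_tensor :: "('k::field \<Rightarrow> 'c::ab_group_add \<Rightarrow> 'c)
    \<Rightarrow> ('k \<Rightarrow> 'a::ab_group_add \<Rightarrow> 'a) \<Rightarrow> ('k \<Rightarrow> 'b::ab_group_add \<Rightarrow> 'b)
    \<Rightarrow> ('c \<Rightarrow> ('a, 'b, 'k) ten) \<Rightarrow> bool" where
  "linear_to_tensor s s1 s2 D \<longleftrightarrow>
     Vector_Spaces.linear s tscale D \<and> range D \<subseteq> tensor_space s1 s2"


lemma vector_space_field: "vector_space ((*) :: 'k::field \<Rightarrow> 'k \<Rightarrow> 'k)"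
  by unfold_locales (auto simp: algebra_simps)

interpretation ten: vector_space "tscale :: 'k::field \<Rightarrow> ('a, 'b, 'k) ten \<Rightarrow> _"
  by unfold_locales (auto simp: tscale_def fun_eq_iff algebra_simps)

lemma dual_comp:
  assumes "Vector_Spaces.linear s s' F" "f \<in> dual s'"
  shows "f \<circ> F \<in> dual s"
  using assms by (auto simp: dual_def intro: Vector_Spaces.linear_compose)

lemma tensor_bilinear:
  assumes "vector_space s1" "vector_space s2"
  shows "bilinear_map s1 s2 tscale (tensor s1 s2)"
proof -
  have "tensor s1 s2 (x + x') y = tensor s1 s2 x y + tensor s1 s2 x' y"
    "tensor s1 s2 x (y + y') = tensor s1 s2 x y + tensor s1 s2 x y'"
    "tensor s1 s2 (s1 c x) y = tscale c (tensor s1 s2 x y)"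
    "tensor s1 s2 x (s2 c y) = tscale c (tensor s1 s2 x y)" for x x' y y' c
    unfolding fun_eq_iff
    by (auto simp: tensor_def tscale_def dual_def Vector_Spaces.linear_iff algebra_simps)
  then show ?thesis
    using assms by (simp add: bilinear_map_def Vector_Spaces.linear_iff ten.vector_space_axioms)
qed

lemma tswap_tensor: "tswap (tensor s1 s2 x y) = tensor s2 s1 y x"
  by (auto simp: tswap_def tensor_def fun_eq_iff)

lemma tswap12_tensor3: "tswap12 (tensor3 s1 s2 s3 x y z) = tensor3 s2 s1 s3 y x z"
  by (auto simp: tswap12_def tensor3_def fun_eq_iff)

lemma tmap_tensor:
  assumes "Vector_Spaces.linear s1 s1' F" "Vector_Spaces.linear s2 s2' G"
  shows "tmap s1' s2' F G (tensor s1 s2 x y) = tensor s1' s2' (F x) (G y)"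
  using dual_comp[OF assms(1)] dual_comp[OF assms(2)]
  by (auto simp: tmap_def tensor_def fun_eq_iff)

lemma tmap_linear: "Vector_Spaces.linear tscale tscale (tmap s1 s2 F G)"
  by (auto simp: Vector_Spaces.linear_iff ten.vector_space_axioms tmap_def tscale_def fun_eq_iff)

lemma sum_ten_apply: "(\<Sum>k\<in>K. t k) f g = (\<Sum>k\<in>K. t k f g)" for t :: "'c \<Rightarrow> ('a, 'b, 'k::field) ten"
  by (induction K rule: infinite_finite_induct) auto

lemma sum_ten3_apply: "(\<Sum>k\<in>K. t k) f g h = (\<Sum>k\<in>K. t k f g h)"
  for t :: "'d \<Rightarrow> ('a, 'b, 'c, 'k::field) ten3"
  by (induction K rule: infinite_finite_induct) auto

lemma tmap_left_tensor:
  assumes F: "Vector_Spaces.linear s s F" and D: "linear_to_tensor s s s D"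
    and y: "D y = (\<Sum>k\<in>K. tensor s s (b k) (c k))"
  shows "tmap_left s F D (tensor s s x y) = (\<Sum>k\<in>K. tensor3 s s s (F x) (b k) (c k))"
proof (intro ext)
  fix f g h
  have *: "(\<lambda>y. D y g h) \<in> dual s"
    using D by (auto simp: dual_def linear_to_tensor_def Vector_Spaces.linear_iff tscale_def
        vector_space_field)
  show "tmap_left s F D (tensor s s x y) f g h =
      (\<Sum>k\<in>K. tensor3 s s s (F x) (b k) (c k)) f g h"
    proof (cases "f \<in> dual s \<and> g \<in> dual s \<and> h \<in> dual s")
      case True
      then have "f \<circ> F \<in> dual s" using dual_comp[OF F] by blast
      then show ?thesis
        using True * by (simp add: tmap_left_def y sum_ten_apply sum_ten3_apply tensor_def tensor3_def
          sum_distrib_left mult.assoc)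
    qed (auto simp: tmap_left_def sum_ten3_apply tensor3_def)
qed

lemma tmap_right_tensor:
  assumes F: "Vector_Spaces.linear s s F" and D: "linear_to_tensor s s s D"
    and x: "D x = (\<Sum>k\<in>K. tensor s s (b k) (c k))"
  shows "tmap_right s D F (tensor s s x y) = (\<Sum>k\<in>K. tensor3 s s s (b k) (c k) (F y))"
proof (intro ext)
  fix f g h
  have *: "(\<lambda>x. D x f g) \<in> dual s"
    using D by (auto simp: dual_def linear_to_tensor_def Vector_Spaces.linear_iff tscale_def
        vector_space_field)
  show "tmap_right s D F (tensor s s x y) f g h =
      (\<Sum>k\<in>K. tensor3 s s s (b k) (c k) (F y)) f g h"
    proof (cases "f \<in> dual s \<and> g \<in> dual s \<and> h \<in> dual s")
      case True
      then have "h \<circ> F \<in> dual s" using dual_comp[OF F] by blast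
      then show ?thesis
        using True * by (simp add: tmap_right_def x sum_ten_apply sum_ten3_apply tensor_def tensor3_def
          sum_distrib_right)
    qed (auto simp: tmap_right_def sum_ten3_apply tensor3_def)
qed

text \<open>Every bilinear map on \<open>V \<times> W\<close> factors through \<open>tensor\<close>, by a linear map that is unique
  on \<open>tensor_space\<close> (linear maps here are defined on the ambient function space).\<close>

lemma tensor_universal:
  fixes s1 :: "'k::field \<Rightarrow> 'a::ab_group_add \<Rightarrow> 'a"
    and s2 :: "'k \<Rightarrow> 'b::ab_group_add \<Rightarrow> 'b"
    and s3 :: "'k \<Rightarrow> 'c::ab_group_add \<Rightarrow> 'c"
  assumes "bilinear_map s1 s2 s3 b"
  shows "\<exists>L. Vector_Spaces.linear tscale s3 L \<and> (\<forall>x y. L (tensor s1 s2 x y) = b x y) \<and>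
     (\<forall>L'. Vector_Spaces.linear tscale s3 L' \<and> (\<forall>x y. L' (tensor s1 s2 x y) = b x y)
        \<longrightarrow> (\<forall>t \<in> tensor_space s1 s2. L' t = L t))"
proof -
  interpret v1: vector_space s1
    using assms by (auto simp: bilinear_map_def Vector_Spaces.linear_iff)
  interpret v2: vector_space s2
    using assms by (auto simp: bilinear_map_def Vector_Spaces.linear_iff)
  interpret v3: vector_space s3
    using assms by (auto simp: bilinear_map_def Vector_Spaces.linear_iff)
  interpret pT: vector_space_pair tscale s3 ..
  interpret p13: vector_space_pair s1 s3 ..
  interpret p23: vector_space_pair s2 s3 ..
  obtain B1 where B1: "v1.independent B1" "v1.span B1 = UNIV"
    
    by (meson v1.maximal_independent_subset subset_UNIV top_le)
  obtain B2 where B2: "v2.independent B2" "v2.span B2 = UNIV"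
    
    by (meson v2.maximal_independent_subset subset_UNIV top_le)
  let ?T = "tensor s1 s2"
  define r1 where "r1 u = (\<lambda>x. v1.representation B1 x u)" for u
  define r2 where "r2 u = (\<lambda>x. v2.representation B2 x u)" for u
  have r1d: "r1 u \<in> dual s1" for u
    using B1 by (auto simp: dual_def r1_def Vector_Spaces.linear_iff v1.vector_space_axioms
        vector_space_field v1.representation_add v1.representation_scale)
  have r2d: "r2 u \<in> dual s2" for u
    using B2 by (auto simp: dual_def r2_def Vector_Spaces.linear_iff v2.vector_space_axioms
        vector_space_field v2.representation_add v2.representation_scale)
  have ev: "?T x y (r1 u) (r2 w) = (if x = u \<and> y = w then 1 else 0)"
    if "x \<in> B1" "y \<in> B2" for x y u w
    using that r1d r2d
    by (simp add: tensor_def r1_def r2_def v1.representation_basis[OF B1(1)]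
        v2.representation_basis[OF B2(1)])
  define X where "X = (\<lambda>(x, y). ?T x y) ` (B1 \<times> B2)"
  have inj: "inj_on (\<lambda>(x, y). ?T x y) (B1 \<times> B2)"
  proof (rule inj_onI, clarify)
    fix x y x' y'
    assume h: "x \<in> B1" "y \<in> B2" "x' \<in> B1" "y' \<in> B2" "?T x y = ?T x' y'"
    show "x = x' \<and> y = y'"
      using ev[OF h(1,2), of x y] ev[OF h(3,4), of x y] unfolding h(5) by (metis zero_neq_one)
  qed
  have scalars: "u t = 0"
    if Y: "finite Y" "Y \<subseteq> X" and z: "(\<Sum>t\<in>Y. tscale (u t) t) = 0" and t: "t \<in> Y"
    for Y u t
  proof -
    obtain x y where xy: "x \<in> B1" "y \<in> B2" "t = ?T x y"
      using Y t by (auto simp: X_def)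
    have "0 = (\<Sum>t\<in>Y. tscale (u t) t) (r1 x) (r2 y)" using z by simp
    also have "\<dots> = (\<Sum>t'\<in>Y. if t' = t then u t else 0)"
      unfolding sum_ten_apply
    proof (rule sum.cong[OF refl])
      fix t' assume "t' \<in> Y"
      then obtain x' y' where xy': "x' \<in> B1" "y' \<in> B2" "t' = ?T x' y'"
        using Y by (auto simp: X_def)
      then have "t' = t \<longleftrightarrow> x' = x \<and> y' = y"
        using inj_onD[OF inj, of "(x', y')" "(x, y)"] xy by auto
      then show "tscale (u t') t' (r1 x) (r2 y) = (if t' = t then u t else 0)"
        using ev[OF xy'(1,2), of x y] xy'(3) by (auto simp: tscale_def)
    qed
    also have "\<dots> = u t" using Y t by simp
    finally show ?thesis by simp
  qed
  have "ten.independent X"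
    apply (rule ten.independent_explicit_module[THEN iffD2])
    apply (intro allI impI)
    subgoal for Y u t by (rule scalars[of Y u t])
    done
  from pT.linear_independent_extend[OF this,
      of "\<lambda>t. case the_inv_into (B1 \<times> B2) (\<lambda>(x, y). ?T x y) t of (x, y) \<Rightarrow> b x y"]
  obtain L where L: "Vector_Spaces.linear tscale s3 L"
    and LX: "\<forall>t\<in>X. L t = (case the_inv_into (B1 \<times> B2) (\<lambda>(x, y). ?T x y) t of (x, y) \<Rightarrow> b x y)"
    by (elim exE conjE)
  have tb: "bilinear_map s1 s2 tscale ?T"
    by (rule tensor_bilinear) unfold_locales
  have LB: "L (?T x y) = b x y" if "x \<in> B1" "y \<in> B2" for x y
  proof -
    have "?T x y \<in> X" using that by (auto simp: X_def)
    then show ?thesis using LX the_inv_into_f_f[OF inj, of "(x, y)"] that by simp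
  qed
  have c2: "Vector_Spaces.linear s2 s3 (\<lambda>y. L (?T x y))" for x
    using Vector_Spaces.linear_compose[OF _ L, of s2 "?T x"] tb
    by (auto simp: bilinear_map_def o_def)
  have c1: "Vector_Spaces.linear s1 s3 (\<lambda>x. L (?T x y))" for y
    using Vector_Spaces.linear_compose[OF _ L, of s1 "\<lambda>x. ?T x y"] tb
    by (auto simp: bilinear_map_def o_def)
  have 1: "L (?T x y) = b x y" if "x \<in> B1" for x y
    by (rule p23.linear_eq_on[OF c2, where B = B2 and g = "b x" and x = y])
      (use assms that LB B2 in \<open>auto simp: bilinear_map_def\<close>)
  have 2: "L (?T x y) = b x y" for x y
    by (rule p13.linear_eq_on[OF c1, where B = B1 and g = "\<lambda>x. b x y" and x = x])
      (use assms 1 B1 in \<open>auto simp: bilinear_map_def\<close>)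
  show ?thesis
  proof (intro exI conjI allI impI ballI)
    show "Vector_Spaces.linear tscale s3 L" by fact
    show "L (?T x y) = b x y" for x y by (rule 2)
    fix L' t
    assume L': "Vector_Spaces.linear tscale s3 L' \<and> (\<forall>x y. L' (?T x y) = b x y)"
      and t: "t \<in> tensor_space s1 s2"
    show "L' t = L t"
      by (rule pT.linear_eq_on[where f = "L'" and g = L and x = t and B = "{?T x y |x y. True}"])
        (use L' L t 2 in \<open>auto simp: tensor_space_def\<close>)
  qed
qed


section \<open>Hom-Lie bialgebras\<close>

record ('k, 'h) hom_vs =
  scl :: "'k \<Rightarrow> 'h \<Rightarrow> 'h"
  twist :: "'h \<Rightarrow> 'h"

record ('k, 'h) hlb_struct =
  brk :: "'h \<Rightarrow> 'h \<Rightarrow> 'h"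
  cobrk :: "'h \<Rightarrow> ('h, 'h, 'k) ten"

definition hom_vector_space :: "('k::field, 'h::ab_group_add) hom_vs \<Rightarrow> bool" where
  "hom_vector_space H \<longleftrightarrow>
     vector_space (scl H) \<and> Vector_Spaces.linear (scl H) (scl H) (twist H)"

definition hom_lie_algebra ::
    "('k::field, 'h::ab_group_add) hom_vs \<Rightarrow> ('h \<Rightarrow> 'h \<Rightarrow> 'h) \<Rightarrow> bool" where
  "hom_lie_algebra H b \<longleftrightarrow>
     hom_vector_space H \<and>
     bilinear_map (scl H) (scl H) (scl H) b \<and>
     (\<forall>x y. b x y = - b y x) \<and>
     (\<forall>x y z. b (twist H x) (b y z) + b (twist H y) (b z x) + b (twist H z) (b x y) = 0)"

definition hom_lie_coalgebra ::
    "('k::field, 'h::ab_group_add) hom_vs \<Rightarrow> ('h \<Rightarrow> ('h, 'h, 'k) ten) \<Rightarrow> bool" where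
  "hom_lie_coalgebra H D \<longleftrightarrow>
     hom_vector_space H \<and>
     linear_to_tensor (scl H) (scl H) (scl H) D \<and>
     (\<forall>x. D x = - tswap (D x)) \<and>
     (\<forall>x. tmap_left (scl H) (twist H) D (D x) =
            tmap_right (scl H) D (twist H) (D x) +
            tswap12 (tmap_left (scl H) (twist H) D (D x)))"

text \<open>The actions \<open>[z, u]\<close> and \<open>[u, z]\<close> of \<open>z\<close> on a tensor \<open>u\<close>.\<close>

definition act_left :: "('k::field, 'h::ab_group_add) hom_vs \<Rightarrow> ('h \<Rightarrow> 'h \<Rightarrow> 'h)
    \<Rightarrow> 'h \<Rightarrow> ('h, 'h, 'k) ten \<Rightarrow> ('h, 'h, 'k) ten" where
  "act_left H b z u =
     tmap (scl H) (scl H) (\<lambda>v. b z v) (twist H) u + tmap (scl H) (scl H) (twist H) (\<lambda>v. b z v) u"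

definition act_right :: "('k::field, 'h::ab_group_add) hom_vs \<Rightarrow> ('h \<Rightarrow> 'h \<Rightarrow> 'h)
    \<Rightarrow> ('h, 'h, 'k) ten \<Rightarrow> 'h \<Rightarrow> ('h, 'h, 'k) ten" where
  "act_right H b u z =
     tmap (scl H) (scl H) (\<lambda>v. b v z) (twist H) u + tmap (scl H) (scl H) (twist H) (\<lambda>v. b v z) u"

definition hom_lie_bialgebra ::
    "('k::field, 'h::ab_group_add) hom_vs \<Rightarrow> ('k, 'h) hlb_struct \<Rightarrow> bool" where
  "hom_lie_bialgebra H S \<longleftrightarrow>
     hom_lie_algebra H (brk S) \<and>
     hom_lie_coalgebra H (cobrk S) \<and>
     (\<forall>x y. cobrk S (brk S x y) =
              act_left H (brk S) (twist H x) (cobrk S y) +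
              act_right H (brk S) (cobrk S x) (twist H y))"

definition hlb_hom :: "('k::field, 'h::ab_group_add) hom_vs \<Rightarrow> ('k, 'h) hlb_struct
    \<Rightarrow> ('k, 'l::ab_group_add) hom_vs \<Rightarrow> ('k, 'l) hlb_struct \<Rightarrow> ('h \<Rightarrow> 'l) \<Rightarrow> bool" where
  "hlb_hom H S L T F \<longleftrightarrow>
     Vector_Spaces.linear (scl H) (scl L) F \<and>
     (\<forall>x. F (twist H x) = twist L (F x)) \<and>
     (\<forall>x y. F (brk S x y) = brk T (F x) (F y)) \<and>
     (\<forall>x. tmap (scl L) (scl L) F F (cobrk S x) = cobrk T (F x))"

definition hlb_iso :: "('k::field, 'h::ab_group_add) hom_vs \<Rightarrow> ('k, 'h) hlb_struct
    \<Rightarrow> ('k, 'l::ab_group_add) hom_vs \<Rightarrow> ('k, 'l) hlb_struct \<Rightarrow> ('h \<Rightarrow> 'l) \<Rightarrow> bool" where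
  "hlb_iso H S L T F \<longleftrightarrow> hlb_hom H S L T F \<and> bij F"


section \<open>Extensions of a Hom-Lie bialgebra through a complement\<close>

text \<open>\<open>E\<close> contains \<open>A\<close> with complement \<open>V\<close>: the linear maps \<open>i : A \<rightarrow> E\<close> and
  \<open>j : V \<rightarrow> E\<close> are the inclusions, and every element of \<open>E\<close> is uniquely of the form
  \<open>i a + j x\<close>, written \<open>(a, x)\<close> in \<open>A \<oplus> V\<close>.\<close>

definition contains_with_complement :: "('k::field, 'e::ab_group_add) hom_vs
    \<Rightarrow> ('k, 'a::ab_group_add) hom_vs \<Rightarrow> ('k, 'v::ab_group_add) hom_vs
    \<Rightarrow> ('a \<Rightarrow> 'e) \<Rightarrow> ('v \<Rightarrow> 'e) \<Rightarrow> bool" where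
  "contains_with_complement E A V i j \<longleftrightarrow>
     hom_vector_space E \<and> hom_vector_space A \<and> hom_vector_space V \<and>
     Vector_Spaces.linear (scl A) (scl E) i \<and> Vector_Spaces.linear (scl V) (scl E) j \<and>
     bij (\<lambda>(a, x). i a + j x) \<and>
     (\<forall>a x. twist E (i a + j x) = i (twist A a) + j (twist V x))"

definition projA :: "('a \<Rightarrow> 'e::ab_group_add) \<Rightarrow> ('v \<Rightarrow> 'e) \<Rightarrow> 'e \<Rightarrow> 'a" where
  "projA i j e = fst (inv (\<lambda>(a, x). i a + j x) e)"

definition projV :: "('a \<Rightarrow> 'e::ab_group_add) \<Rightarrow> ('v \<Rightarrow> 'e) \<Rightarrow> 'e \<Rightarrow> 'v" where
  "projV i j e = snd (inv (\<lambda>(a, x). i a + j x) e)"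

definition bext :: "('k::field, 'e::ab_group_add) hom_vs \<Rightarrow> ('k, 'a::ab_group_add) hom_vs
    \<Rightarrow> ('k, 'a) hlb_struct \<Rightarrow> ('a \<Rightarrow> 'e) \<Rightarrow> ('v::ab_group_add \<Rightarrow> 'e) \<Rightarrow> ('k, 'e) hlb_struct set" where
  "bext E A SA i j =
     {S. hom_lie_bialgebra E S \<and> (hlb_hom A SA E S i \<or> hlb_hom E S A SA (projA i j))}"

definition bext_equiv :: "('k::field, 'e::ab_group_add) hom_vs \<Rightarrow> ('k, 'a::ab_group_add) hom_vs
    \<Rightarrow> ('k, 'a) hlb_struct \<Rightarrow> ('a \<Rightarrow> 'e) \<Rightarrow> ('v::ab_group_add \<Rightarrow> 'e)
    \<Rightarrow> (('k, 'e) hlb_struct \<times> ('k, 'e) hlb_struct) set" where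
  "bext_equiv E A SA i j =
     {(S, T). S \<in> bext E A SA i j \<and> T \<in> bext E A SA i j \<and>
              (\<exists>F. hlb_iso E S E T F \<and> (\<forall>a. F (i a) = i a))}"

definition BExtd :: "('k::field, 'e::ab_group_add) hom_vs \<Rightarrow> ('k, 'a::ab_group_add) hom_vs
    \<Rightarrow> ('k, 'a) hlb_struct \<Rightarrow> ('a \<Rightarrow> 'e) \<Rightarrow> ('v::ab_group_add \<Rightarrow> 'e)
    \<Rightarrow> ('k, 'e) hlb_struct set set" where
  "BExtd E A SA i j = bext E A SA i j // bext_equiv E A SA i j"


section \<open>Extending data and unified products\<close>

text \<open>A linear map out of a tensor product \<open>V \<otimes> A\<close> is given by the corresponding bilinear map
  (see \<open>tensor_universal\<close>).\<close>

record ('k, 'a, 'v) datum1 =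
  ract1 :: "'v \<Rightarrow> 'a \<Rightarrow> 'v"
  theta1 :: "'a \<Rightarrow> 'a \<Rightarrow> 'v"
  phi1 :: "'a \<Rightarrow> ('v, 'a, 'k) ten"
  psi1 :: "'v \<Rightarrow> ('v, 'a, 'k) ten"
  P1 :: "'a \<Rightarrow> ('v, 'v, 'k) ten"
  brkV1 :: "'v \<Rightarrow> 'v \<Rightarrow> 'v"
  cobrkV1 :: "'v \<Rightarrow> ('v, 'v, 'k) ten"

record ('k, 'a, 'v) datum2 =
  lact2 :: "'v \<Rightarrow> 'a \<Rightarrow> 'a"
  ract2 :: "'v \<Rightarrow> 'a \<Rightarrow> 'v"
  sigma2 :: "'v \<Rightarrow> 'v \<Rightarrow> 'a"
  psi2 :: "'v \<Rightarrow> ('v, 'a, 'k) ten"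
  Q2 :: "'v \<Rightarrow> ('a, 'a, 'k) ten"
  brkV2 :: "'v \<Rightarrow> 'v \<Rightarrow> 'v"
  cobrkV2 :: "'v \<Rightarrow> ('v, 'v, 'k) ten"

text \<open>\<open>emb\<close> makes explicit the embeddings of \<open>A \<otimes> A\<close>, \<open>V \<otimes> A\<close> etc. into \<open>E \<otimes> E\<close>.\<close>

abbreviation emb :: "('k::field, 'e::ab_group_add) hom_vs \<Rightarrow> ('b \<Rightarrow> 'e) \<Rightarrow> ('c \<Rightarrow> 'e)
    \<Rightarrow> ('b, 'c, 'k) ten \<Rightarrow> ('e, 'e, 'k) ten" where
  "emb E F G \<equiv> tmap (scl E) (scl E) F G"

definition unified1 :: "('k::field, 'e::ab_group_add) hom_vs \<Rightarrow> ('k, 'a::ab_group_add) hlb_struct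
    \<Rightarrow> ('a \<Rightarrow> 'e) \<Rightarrow> ('v::ab_group_add \<Rightarrow> 'e) \<Rightarrow> ('k, 'a, 'v) datum1 \<Rightarrow> ('k, 'e) hlb_struct" where
  "unified1 E SA i j D = \<lparr>
     brk = (\<lambda>e e'. let a = projA i j e; x = projV i j e; b = projA i j e'; y = projV i j e' in
       i (brk SA a b) +
       j (brkV1 D x y + ract1 D x b - ract1 D y a + theta1 D a b)),
     cobrk = (\<lambda>e. let a = projA i j e; x = projV i j e in
       (emb E i i (cobrk SA a) + emb E j i (phi1 D a) - emb E i j (tswap (phi1 D a)) + emb E j j (P1 D a)) +
       (emb E j j (cobrkV1 D x) + emb E j i (psi1 D x) - emb E i j (tswap (psi1 D x))))\<rparr>"

definition unified2 :: "('k::field, 'e::ab_group_add) hom_vs \<Rightarrow> ('k, 'a::ab_group_add) hlb_struct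
    \<Rightarrow> ('a \<Rightarrow> 'e) \<Rightarrow> ('v::ab_group_add \<Rightarrow> 'e) \<Rightarrow> ('k, 'a, 'v) datum2 \<Rightarrow> ('k, 'e) hlb_struct" where
  "unified2 E SA i j D = \<lparr>
     brk = (\<lambda>e e'. let a = projA i j e; x = projV i j e; b = projA i j e'; y = projV i j e' in
       i (brk SA a b + lact2 D x b - lact2 D y a + sigma2 D x y) +
       j (brkV2 D x y + ract2 D x b - ract2 D y a)),
     cobrk = (\<lambda>e. let a = projA i j e; x = projV i j e in
       emb E i i (cobrk SA a) +
       (emb E j j (cobrkV2 D x) + emb E j i (psi2 D x) - emb E i j (tswap (psi2 D x)) + emb E i i (Q2 D x)))\<rparr>"

definition LB1 :: "('k::field, 'e::ab_group_add) hom_vs \<Rightarrow> ('k, 'a::ab_group_add) hom_vs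
    \<Rightarrow> ('k, 'a) hlb_struct \<Rightarrow> ('k, 'v::ab_group_add) hom_vs \<Rightarrow> ('a \<Rightarrow> 'e) \<Rightarrow> ('v \<Rightarrow> 'e)
    \<Rightarrow> ('k, 'a, 'v) datum1 set" where
  "LB1 E A SA V i j = {D.
     bilinear_map (scl V) (scl A) (scl V) (ract1 D) \<and>
     bilinear_map (scl A) (scl A) (scl V) (theta1 D) \<and>
     linear_to_tensor (scl A) (scl V) (scl A) (phi1 D) \<and>
     linear_to_tensor (scl V) (scl V) (scl A) (psi1 D) \<and>
     linear_to_tensor (scl A) (scl V) (scl V) (P1 D) \<and>
     bilinear_map (scl V) (scl V) (scl V) (brkV1 D) \<and>
     linear_to_tensor (scl V) (scl V) (scl V) (cobrkV1 D) \<and>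
     hom_lie_bialgebra E (unified1 E SA i j D)}"

definition LB2 :: "('k::field, 'e::ab_group_add) hom_vs \<Rightarrow> ('k, 'a::ab_group_add) hom_vs
    \<Rightarrow> ('k, 'a) hlb_struct \<Rightarrow> ('k, 'v::ab_group_add) hom_vs \<Rightarrow> ('a \<Rightarrow> 'e) \<Rightarrow> ('v \<Rightarrow> 'e)
    \<Rightarrow> ('k, 'a, 'v) datum2 set" where
  "LB2 E A SA V i j = {D.
     bilinear_map (scl V) (scl A) (scl A) (lact2 D) \<and>
     bilinear_map (scl V) (scl A) (scl V) (ract2 D) \<and>
     bilinear_map (scl V) (scl V) (scl A) (sigma2 D) \<and>
     linear_to_tensor (scl V) (scl V) (scl A) (psi2 D) \<and>
     linear_to_tensor (scl V) (scl A) (scl A) (Q2 D) \<and>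
     bilinear_map (scl V) (scl V) (scl V) (brkV2 D) \<and>
     linear_to_tensor (scl V) (scl V) (scl V) (cobrkV2 D) \<and>
     hom_lie_bialgebra E (unified2 E SA i j D)}"

definition LB :: "('k::field, 'e::ab_group_add) hom_vs \<Rightarrow> ('k, 'a::ab_group_add) hom_vs
    \<Rightarrow> ('k, 'a) hlb_struct \<Rightarrow> ('k, 'v::ab_group_add) hom_vs \<Rightarrow> ('a \<Rightarrow> 'e) \<Rightarrow> ('v \<Rightarrow> 'e)
    \<Rightarrow> (('k, 'a, 'v) datum1 + ('k, 'a, 'v) datum2) set" where
  "LB E A SA V i j = LB1 E A SA V i j <+> LB2 E A SA V i j"

definition unified :: "('k::field, 'e::ab_group_add) hom_vs \<Rightarrow> ('k, 'a::ab_group_add) hlb_struct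
    \<Rightarrow> ('a \<Rightarrow> 'e) \<Rightarrow> ('v::ab_group_add \<Rightarrow> 'e)
    \<Rightarrow> ('k, 'a, 'v) datum1 + ('k, 'a, 'v) datum2 \<Rightarrow> ('k, 'e) hlb_struct" where
  "unified E SA i j = case_sum (unified1 E SA i j) (unified2 E SA i j)"

definition phi_rs :: "('a \<Rightarrow> 'e::ab_group_add) \<Rightarrow> ('v \<Rightarrow> 'e) \<Rightarrow> ('v \<Rightarrow> 'a::ab_group_add) \<Rightarrow> ('v \<Rightarrow> 'v)
    \<Rightarrow> 'e \<Rightarrow> 'e" where
  "phi_rs i j r s e = i (projA i j e + r (projV i j e)) + j (s (projV i j e))"

definition LB_equiv :: "('k::field, 'e::ab_group_add) hom_vs \<Rightarrow> ('k, 'a::ab_group_add) hom_vs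
    \<Rightarrow> ('k, 'a) hlb_struct \<Rightarrow> ('k, 'v::ab_group_add) hom_vs \<Rightarrow> ('a \<Rightarrow> 'e) \<Rightarrow> ('v \<Rightarrow> 'e)
    \<Rightarrow> ((('k, 'a, 'v) datum1 + ('k, 'a, 'v) datum2) \<times>
        (('k, 'a, 'v) datum1 + ('k, 'a, 'v) datum2)) set" where
  "LB_equiv E A SA V i j =
     {(D, D'). D \<in> LB E A SA V i j \<and> D' \<in> LB E A SA V i j \<and>
        (\<exists>r s. Vector_Spaces.linear (scl V) (scl A) r \<and> Vector_Spaces.linear (scl V) (scl V) s \<and>
           hlb_iso E (unified E SA i j D) E (unified E SA i j D') (phi_rs i j r s))}"

definition HLB :: "('k::field, 'e::ab_group_add) hom_vs \<Rightarrow> ('k, 'a::ab_group_add) hom_vs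
    \<Rightarrow> ('k, 'a) hlb_struct \<Rightarrow> ('k, 'v::ab_group_add) hom_vs \<Rightarrow> ('a \<Rightarrow> 'e) \<Rightarrow> ('v \<Rightarrow> 'e)
    \<Rightarrow> (('k, 'a, 'v) datum1 + ('k, 'a, 'v) datum2) set set" where
  "HLB E A SA V i j = LB E A SA V i j // LB_equiv E A SA V i j"

text \<open>The map sending the class of a datum to the class of its unified product, lifted to the
  quotient with the library's idiom for functions on equivalence classes (\<open>UN_equiv_class\<close>).\<close>

definition Upsilon :: "('k::field, 'e::ab_group_add) hom_vs \<Rightarrow> ('k, 'a::ab_group_add) hom_vs
    \<Rightarrow> ('k, 'a) hlb_struct \<Rightarrow> ('a \<Rightarrow> 'e) \<Rightarrow> ('v::ab_group_add \<Rightarrow> 'e)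
    \<Rightarrow> (('k, 'a, 'v) datum1 + ('k, 'a, 'v) datum2) set \<Rightarrow> ('k, 'e) hlb_struct set" where
  "Upsilon E A SA i j c = (\<Union>D\<in>c. bext_equiv E A SA i j `` {unified E SA i j D})"

end

theory Submission
  imports Defs
begin

text \<open>
  A linear endomorphism \<open>F\<close> of \<open>E = A \<oplus> V\<close> fixes \<open>A\<close> pointwise iff it is some \<open>\<phi>\<^sub>r\<^sub>,\<^sub>s\<close> (take for \<open>r\<close>, \<open>s\<close>
  the components of \<open>F\<close> on \<open>V\<close>), so \<open>\<equiv>\<close> is the preimage of the equivalence of bialgebra structures
  under the unified product. It remains to see that the unified products are exactly the
  structures in question. If \<open>p\<close> or \<open>i\<close> is a homomorphism, the \<open>A\<close>-components of the structure
  on \<open>A\<close> are those of \<open>A\<close>. Of the other components, \<open>p\<close> being a homomorphism forces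
  \<open>\<triangleright>\<close>, \<open>\<sigma>\<close>, \<open>Q\<close> to vanish (type I) and \<open>i\<close> being one forces \<open>\<theta>\<close>, \<open>\<phi>\<close>, \<open>P\<close> to vanish
  (type II), while skew-symmetry reduces \<open>A \<times> V\<close> to \<open>V \<times> A\<close> and \<open>A \<otimes> V\<close> to \<open>V \<otimes> A\<close>.
\<close>

section \<open>Pulling back an equivalence relation along a surjection\<close>

text \<open>Classes of \<open>Q\<close> are the preimages of classes of \<open>R\<close>, so
  injectivity on classes is built into \<open>Q\<close>, and surjectivity comes from
  \<open>f\<close> mapping onto \<open>Y\<close>. \<open>U\<close> has the shape of
  \<open>Upsilon\<close>.\<close>

lemma quotient_preimage_bij:
  assumes R: "equiv Y R" and f: "f ` X = Y"
    and Q: "Q = {(x, x'). x \<in> X \<and> x' \<in> X \<and> (f x, f x') \<in> R}"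
  defines "U \<equiv> \<lambda>c. \<Union>x\<in>c. R `` {f x}"
  shows "equiv X Q" and "\<And>x. x \<in> X \<Longrightarrow> U (Q `` {x}) = R `` {f x}"
    and "bij_betw U (X // Q) (Y // R)"
proof -
  have fY: "f x \<in> Y" if "x \<in> X" for x using f that by blast
  show eq: "equiv X Q"
    using R fY unfolding Q equiv_def refl_on_def sym_def trans_def by blast
  have iff: "(x, x') \<in> Q \<longleftrightarrow> (f x, f x') \<in> R" if "x \<in> X" "x' \<in> X" for x x'
    using that Q by blast
  \<comment> \<open>Related points contribute the same \<open>R\<close>-class, so on a class of
    \<open>Q\<close> the union defining \<open>U\<close> is over a constant family.\<close>
  have "congruent Q (\<lambda>x. R `` {f x})"
    unfolding congruent_def Q using equiv_class_eq[OF R] by blast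
  then show U: "U (Q `` {x}) = R `` {f x}" if "x \<in> X" for x
    unfolding U_def using UN_equiv_class[OF eq _ that, of "\<lambda>x. R `` {f x}"] by simp
  show "bij_betw U (X // Q) (Y // R)"
  proof (rule bij_betwI')
    fix c d assume "c \<in> X // Q" "d \<in> X // Q"
    then obtain x y where "x \<in> X" "c = Q `` {x}" "y \<in> X" "d = Q `` {y}"
      by (auto elim!: quotientE)
    then show "U c = U d \<longleftrightarrow> c = d"
      using U iff fY eq_equiv_class_iff[OF eq] eq_equiv_class_iff[OF R] by simp
  next
    fix c assume "c \<in> X // Q"
    then show "U c \<in> Y // R"
      using U fY by (auto elim!: quotientE intro!: quotientI)
  next
    fix d assume "d \<in> Y // R"
    then obtain x where "x \<in> X" "d = R `` {f x}"
      using f by (auto elim!: quotientE)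
    then show "\<exists>c\<in>X // Q. d = U c"
      using U by (auto intro: quotientI)
  qed
qed


section \<open>Tensors\<close>

lemma dual_add: "f \<in> dual s \<Longrightarrow> g \<in> dual s \<Longrightarrow> f + g \<in> dual s"
  by (auto simp: dual_def Vector_Spaces.linear_iff algebra_simps)

text \<open>The scalar is attached to the pure tensor, so an induction needs no separate case for
  scaling.\<close>

lemma tensor_space_induct [consumes 1, case_names zero tensor add]:
  assumes "t \<in> tensor_space s1 s2"
    and "P 0"
    and "\<And>c x y. P (tscale c (tensor s1 s2 x y))"
    and "\<And>t u. P t \<Longrightarrow> P u \<Longrightarrow> P (t + u)"
  shows "P t"
  using assms(1) unfolding tensor_space_def
proof (induction rule: ten.span_induct_alt)
  case base
  show ?case by (rule assms(2))
next
  case (step c x y)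
  then show ?case using assms(3,4) by blast
qed

text \<open>The span inherits the vanishing of pure tensors off the functionals, which matches the
  default value 0 in \<open>tmap\<close>.\<close>

lemma tensor_space_outside:
  assumes "t \<in> tensor_space s1 s2" and "f \<notin> dual s1 \<or> g \<notin> dual s2"
  shows "t f g = 0"
  using assms by (induction rule: tensor_space_induct) (auto simp: tensor_def tscale_def)

text \<open>Both summands must be functionals, since the default value 0 elsewhere breaks
  additivity; \<open>g\<close> may be arbitrary.\<close>

lemma tensor_space_add_left:
  assumes "t \<in> tensor_space s1 s2" and "f \<in> dual s1" "f' \<in> dual s1"
  shows "t (f + f') g = t f g + t f' g"
  using assms
  by (induction rule: tensor_space_induct)
    (auto simp: tensor_def tscale_def dual_add algebra_simps)

lemma tensor_space_add_right:
  assumes "t \<in> tensor_space s1 s2" and "g \<in> dual s2" "g' \<in> dual s2"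
  shows "t f (g + g') = t f g + t f g'"
  using assms
  by (induction rule: tensor_space_induct)
    (auto simp: tensor_def tscale_def dual_add algebra_simps)

lemma tensor_space_zero_left:
  assumes "t \<in> tensor_space s1 s2"
  shows "t 0 g = 0"
  using assms by (induction rule: tensor_space_induct) (auto simp: tensor_def tscale_def)

lemma tensor_space_zero_right:
  assumes "t \<in> tensor_space s1 s2"
  shows "t f 0 = 0"
  using assms by (induction rule: tensor_space_induct) (auto simp: tensor_def tscale_def)

lemma tmap_zero: "tmap s1 s2 F G 0 = 0"
  by (auto simp: tmap_def fun_eq_iff)

lemma tswap_zero: "tswap 0 = 0"
  by (auto simp: tswap_def fun_eq_iff)

lemma tmap_add: "tmap s1 s2 F G (t + u) = tmap s1 s2 F G t + tmap s1 s2 F G u"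
  by (auto simp: tmap_def fun_eq_iff)

lemma tswap_add: "tswap (t + u) = tswap t + tswap u"
  by (auto simp: tswap_def fun_eq_iff)

text \<open>Since \<open>tmap\<close> acts on the whole ambient function space, that it respects the
  spans is checked on pure tensors and extended by linearity.\<close>

lemma tmap_in_tensor_space:
  assumes "t \<in> tensor_space s1 s2"
    and F: "Vector_Spaces.linear s1 s1' F" and G: "Vector_Spaces.linear s2 s2' G"
  shows "tmap s1' s2' F G t \<in> tensor_space s1' s2'"
  using assms(1)
proof (induction rule: tensor_space_induct)
  case zero
  show ?case unfolding tensor_space_def tmap_zero by (rule ten.span_zero)
next
  case (tensor c x y)
  have "tmap s1' s2' F G (tscale c (tensor s1 s2 x y)) = tscale c (tensor s1' s2' (F x) (G y))"
    using tmap_tensor[OF F G, of x y] tmap_linear[of s1' s2' F G]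
    by (simp add: Vector_Spaces.linear_iff)
  moreover have "tscale c (tensor s1' s2' (F x) (G y)) \<in> ten.span {tensor s1' s2' x y |x y. True}"
    by (rule ten.span_scale[OF ten.span_base]) blast
  ultimately show ?case unfolding tensor_space_def by simp
next
  case (add t u)
  then show ?case unfolding tensor_space_def tmap_add by (rule ten.span_add)
qed

lemma tswap_in_tensor_space:
  assumes "t \<in> tensor_space s1 s2"
  shows "tswap t \<in> tensor_space s2 s1"
  using assms
proof (induction rule: tensor_space_induct)
  case zero
  show ?case unfolding tensor_space_def tswap_zero by (rule ten.span_zero)
next
  case (tensor c x y)
  have "tswap (tscale c (tensor s1 s2 x y)) = tscale c (tensor s2 s1 y x)"
    by (auto simp: tswap_def tscale_def tensor_def fun_eq_iff)
  moreover have "tscale c (tensor s2 s1 y x) \<in> ten.span {tensor s2 s1 x y |x y. True}"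
    by (rule ten.span_scale[OF ten.span_base]) blast
  ultimately show ?case unfolding tensor_space_def by simp
next
  case (add t u)
  then show ?case unfolding tensor_space_def tswap_add by (rule ten.span_add)
qed

lemma tmap_diff: "tmap s1 s2 F G (t - u) = tmap s1 s2 F G t - tmap s1 s2 F G u"
  by (auto simp: tmap_def fun_eq_iff)

text \<open>Linearity of the outer maps suffices: pulling back along them preserves functionals, so
  the inner \<open>tmap\<close> does not fall into its default case.\<close>

lemma tmap_tmap:
  assumes "Vector_Spaces.linear s1' s1 F'" "Vector_Spaces.linear s2' s2 G'"
  shows "tmap s1 s2 F' G' (tmap s1' s2' F G t) = tmap s1 s2 (F' \<circ> F) (G' \<circ> G) t"
  using dual_comp[OF assms(1)] dual_comp[OF assms(2)]
  by (auto simp: tmap_def fun_eq_iff o_assoc)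

text \<open>\<open>tmap\<close> erases all values off the functionals; elements of the tensor space
  have none there to lose.\<close>

lemma tmap_id:
  assumes "t \<in> tensor_space s1 s2"
  shows "tmap s1 s2 id id t = t"
  using tensor_space_outside[OF assms] by (auto simp: tmap_def fun_eq_iff)

lemma dual_comp_zero: "f \<in> dual s \<Longrightarrow> f \<circ> (\<lambda>_. 0) = 0"
  using module_hom.zero[of s "(*)" f]
  by (auto simp: dual_def fun_eq_iff linear_iff_module_hom)

lemma tmap_zero_left:
  assumes "t \<in> tensor_space s1 s2"
  shows "tmap s1' s2' (\<lambda>_. 0) G t = 0"
  using tensor_space_zero_left[OF assms] by (auto simp: tmap_def fun_eq_iff dual_comp_zero)

lemma tmap_zero_right:
  assumes "t \<in> tensor_space s1 s2"
  shows "tmap s1' s2' F (\<lambda>_. 0) t = 0"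
  using tensor_space_zero_right[OF assms] by (auto simp: tmap_def fun_eq_iff dual_comp_zero)

lemma tswap_tmap: "tswap (tmap s1 s2 F G t) = tmap s2 s1 G F (tswap t)"
  by (auto simp: tmap_def tswap_def fun_eq_iff)

lemma tmap_uminus: "tmap s1 s2 F G (- t) = - tmap s1 s2 F G t"
  by (auto simp: tmap_def fun_eq_iff)

lemma linear_to_tensor_zero:
  assumes "linear_to_tensor s s1 s2 D"
  shows "D 0 = 0"
  using assms module_hom.zero[of s tscale D]
  by (simp add: linear_to_tensor_def linear_iff_module_hom)

lemma linear_to_tensor_mem: "linear_to_tensor s s1 s2 D \<Longrightarrow> D x \<in> tensor_space s1 s2"
  by (auto simp: linear_to_tensor_def)

lemma bilinear_map_zero_left:
  assumes "bilinear_map s1 s2 s3 b"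
  shows "b 0 y = 0"
  using assms module_hom.zero[of s1 s3 "\<lambda>x. b x y"]
  by (auto simp: bilinear_map_def linear_iff_module_hom)

lemma linear_to_tensor_tmap:
  assumes D: "linear_to_tensor s s1 s2 D" and h: "Vector_Spaces.linear s' s h"
    and F: "Vector_Spaces.linear s1 s1' F" and G: "Vector_Spaces.linear s2 s2' G"
  shows "linear_to_tensor s' s1' s2' (\<lambda>x. tmap s1' s2' F G (D (h x)))"
proof -
  have "Vector_Spaces.linear s' tscale (\<lambda>x. tmap s1' s2' F G (D (h x)))"
    using D h tmap_linear[of s1' s2' F G]
    by (auto simp: linear_to_tensor_def Vector_Spaces.linear_iff)
  then show ?thesis
    using D tmap_in_tensor_space[OF _ F G] by (auto simp: linear_to_tensor_def)
qed

lemma bilinear_map_comp: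
  assumes "bilinear_map s1 s2 s3 b"
    and "Vector_Spaces.linear s1' s1 f" "Vector_Spaces.linear s2' s2 g"
    and "Vector_Spaces.linear s3 s3' h"
  shows "bilinear_map s1' s2' s3' (\<lambda>x y. h (b (f x) (g y)))"
  using assms unfolding bilinear_map_def Vector_Spaces.linear_iff by simp


section \<open>Isomorphisms\<close>

lemma hlb_iso_id:
  assumes "hom_lie_bialgebra H S"
  shows "hlb_iso H S H S id"
proof -
  have "cobrk S x \<in> tensor_space (scl H) (scl H)" and "vector_space (scl H)" for x
    using assms by (auto simp: hom_lie_bialgebra_def hom_lie_coalgebra_def linear_to_tensor_def
        hom_vector_space_def)
  then show ?thesis
    by (simp add: hlb_iso_def hlb_hom_def tmap_id Vector_Spaces.linear_iff)
qed

text \<open>The bialgebra hypothesis places \<open>cobrk S x\<close> in the tensor space, where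
  \<open>tmap_id\<close> lets the action of \<open>F\<close> be undone.\<close>

lemma hlb_iso_inv:
  assumes "hom_lie_bialgebra H S" and F: "hlb_iso H S L T F"
  shows "hlb_iso L T H S (inv F)"
proof -
  have bij: "bij F" and lin: "Vector_Spaces.linear (scl H) (scl L) F"
    and tw: "F (twist H x) = twist L (F x)" and br: "F (brk S x y) = brk T (F x) (F y)"
    and co: "tmap (scl L) (scl L) F F (cobrk S x) = cobrk T (F x)" for x y
    using F by (auto simp: hlb_iso_def hlb_hom_def)
  have FI: "F (inv F y) = y" and IF: "inv F (F x) = x" for x y
    using bij by (auto simp: bij_is_surj surj_f_inv_f bij_is_inj)
  have linI: "Vector_Spaces.linear (scl L) (scl H) (inv F)"
    unfolding Vector_Spaces.linear_iff
  proof (intro conjI allI)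
    \<comment> \<open>Here and below, \<open>inv F (F u) = u\<close> is used with \<open>u\<close>
      the desired right-hand side, whose image under \<open>F\<close> simplifies.\<close>
    show "inv F (x + y) = inv F x + inv F y" for x y
      using IF[of "inv F x + inv F y"] lin by (simp add: FI Vector_Spaces.linear_iff)
    show "inv F (scl L c x) = scl H c (inv F x)" for c x
      using IF[of "scl H c (inv F x)"] lin by (simp add: FI Vector_Spaces.linear_iff)
  qed (use lin in \<open>auto simp: Vector_Spaces.linear_iff\<close>)
  have mem: "cobrk S x \<in> tensor_space (scl H) (scl H)" for x
    using assms(1) by (auto simp: hom_lie_bialgebra_def hom_lie_coalgebra_def linear_to_tensor_def)
  have "inv F \<circ> F = id" using IF by auto
  then have "tmap (scl H) (scl H) (inv F) (inv F) (cobrk T (F x)) = cobrk S x" for x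
    unfolding co[symmetric] tmap_tmap[OF linI linI] by (simp add: tmap_id mem)
  from this[of "inv F _"]
  have "tmap (scl H) (scl H) (inv F) (inv F) (cobrk T y) = cobrk S (inv F y)" for y
    by (simp add: FI)
  moreover have "inv F (twist L x) = twist H (inv F x)"
    and "inv F (brk T x y) = brk S (inv F x) (inv F y)" for x y
    using IF[of "twist H (inv F x)"] IF[of "brk S (inv F x) (inv F y)"] by (simp_all add: FI tw br)
  ultimately show ?thesis
    using bij linI by (simp add: hlb_iso_def hlb_hom_def bij_imp_bij_inv)
qed

lemma hlb_iso_comp:
  assumes "hlb_iso H S L T F" and "hlb_iso L T M U G"
  shows "hlb_iso H S M U (G \<circ> F)"
proof -
  have G: "Vector_Spaces.linear (scl L) (scl M) G"
    using assms by (simp add: hlb_iso_def hlb_hom_def)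
  have "tmap (scl M) (scl M) (G \<circ> F) (G \<circ> F) t
      = tmap (scl M) (scl M) G G (tmap (scl L) (scl L) F F t)" for t
    by (rule tmap_tmap[OF G G, symmetric])
  moreover have "Vector_Spaces.linear (scl H) (scl M) (G \<circ> F)"
    using assms by (intro Vector_Spaces.linear_compose) (auto simp: hlb_iso_def hlb_hom_def)
  ultimately show ?thesis
    using assms by (simp add: hlb_iso_def hlb_hom_def bij_comp)
qed

text \<open>The identity, inverses and composites of isomorphisms fixing \<open>A\<close> pointwise
  again fix \<open>A\<close> pointwise.\<close>

lemma equiv_bext_equiv: "equiv (bext E A SA i j) (bext_equiv E A SA i j)"
proof (rule equivI)
  show "bext_equiv E A SA i j \<subseteq> bext E A SA i j \<times> bext E A SA i j"
    by (auto simp: bext_equiv_def)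
  show "refl_on (bext E A SA i j) (bext_equiv E A SA i j)"
    using hlb_iso_id[of E]
    by (intro refl_onI) (auto simp: bext_equiv_def bext_def intro!: exI[of _ id])
  show "sym (bext_equiv E A SA i j)"
  proof (rule symI)
    fix S T assume "(S, T) \<in> bext_equiv E A SA i j"
    then obtain F where *: "S \<in> bext E A SA i j" "T \<in> bext E A SA i j"
        "hlb_iso E S E T F" "\<forall>a. F (i a) = i a"
      by (auto simp: bext_equiv_def)
    have "inj F" using * by (simp add: hlb_iso_def bij_is_inj)
    then have "inv F (i a) = i a" for a using * by (metis inv_f_f)
    moreover have "hlb_iso E T E S (inv F)"
      using * hlb_iso_inv by (auto simp: bext_def)
    ultimately show "(T, S) \<in> bext_equiv E A SA i j"
      using * by (auto simp: bext_equiv_def)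
  qed
  show "trans (bext_equiv E A SA i j)"
  proof (rule transI)
    fix S T U
    assume "(S, T) \<in> bext_equiv E A SA i j" "(T, U) \<in> bext_equiv E A SA i j"
    then obtain F G where *: "S \<in> bext E A SA i j" "U \<in> bext E A SA i j"
        "hlb_iso E S E T F" "\<forall>a. F (i a) = i a" "hlb_iso E T E U G" "\<forall>a. G (i a) = i a"
      by (auto simp: bext_equiv_def)
    then have "hlb_iso E S E U (G \<circ> F)" "\<forall>a. (G \<circ> F) (i a) = i a"
      using hlb_iso_comp by auto
    then show "(S, U) \<in> bext_equiv E A SA i j"
      using * by (auto simp: bext_equiv_def)
  qed
qed


section \<open>Unified products\<close>

locale complemented =
  fixes A :: "('k::field, 'a::ab_group_add) hom_vs"
    and SA :: "('k, 'a) hlb_struct"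
    and E :: "('k, 'e::ab_group_add) hom_vs"
    and V :: "('k, 'v::ab_group_add) hom_vs"
    and i :: "'a \<Rightarrow> 'e" and j :: "'v \<Rightarrow> 'e"
  assumes bialgebra_A: "hom_lie_bialgebra A SA"
    and complement: "contains_with_complement E A V i j"
begin

abbreviation "pA \<equiv> projA i j"
abbreviation "pV \<equiv> projV i j"

lemma linear_i: "Vector_Spaces.linear (scl A) (scl E) i"
  and linear_j: "Vector_Spaces.linear (scl V) (scl E) j"
  using complement by (auto simp: contains_with_complement_def)

lemma proj_sum [simp]: "pA (i a + j x) = a" "pV (i a + j x) = x"
proof -
  have "inj (\<lambda>(a, x). i a + j x)"
    using complement by (simp add: contains_with_complement_def bij_is_inj)
  from inv_f_f[OF this, of "(a, x)"] show "pA (i a + j x) = a" "pV (i a + j x) = x"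
    by (simp_all add: projA_def projV_def)
qed

lemma sum_proj: "i (pA e) + j (pV e) = e"
proof -
  have "surj (\<lambda>(a, x). i a + j x)"
    using complement by (simp add: contains_with_complement_def bij_is_surj)
  from surj_f_inv_f[OF this, of e] show ?thesis
    by (simp add: projA_def projV_def split_beta)
qed

lemma decompose: obtains a x where "e = i a + j x"
  using sum_proj[of e, symmetric] by (rule that)

lemma i_zero [simp]: "i 0 = 0" and j_zero [simp]: "j 0 = 0"
  using linear_i linear_j by (auto simp: linear_iff_module_hom module_hom.zero)

lemma proj_incl [simp]: "pA (i a) = a" "pV (i a) = 0" "pA (j x) = 0" "pV (j x) = x"
  using proj_sum[of a 0] proj_sum[of 0 x] by simp_all

lemma vs: "vector_space (scl A)" "vector_space (scl V)" "vector_space (scl E)"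
  using complement by (auto simp: contains_with_complement_def hom_vector_space_def)

lemma i_add: "i (a + b) = i a + i b" and i_scale: "i (scl A c a) = scl E c (i a)"
  and j_add: "j (x + y) = j x + j y" and j_scale: "j (scl V c x) = scl E c (j x)"
  using linear_i linear_j by (auto simp: Vector_Spaces.linear_iff)

text \<open>Adding two decompositions gives a decomposition of the sum, and decompositions are
  unique.\<close>

lemma proj_add: "pA (e + e') = pA e + pA e'" "pV (e + e') = pV e + pV e'"
proof -
  have "e + e' = i (pA e + pA e') + j (pV e + pV e')"
    using sum_proj[of e] sum_proj[of e'] by (simp add: i_add j_add algebra_simps)
  then show "pA (e + e') = pA e + pA e'" "pV (e + e') = pV e + pV e'"
    by (metis proj_sum(1), metis proj_sum(2))
qed

lemma proj_scale: "pA (scl E c e) = scl A c (pA e)" "pV (scl E c e) = scl V c (pV e)"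
proof -
  have "scl E c e = i (scl A c (pA e)) + j (scl V c (pV e))"
    using sum_proj[of e] by (metis i_scale j_scale vs(3) vector_space.vector_space_assms(1))
  then show "pA (scl E c e) = scl A c (pA e)" "pV (scl E c e) = scl V c (pV e)"
    by (metis proj_sum(1), metis proj_sum(2))
qed

lemma linear_pA: "Vector_Spaces.linear (scl E) (scl A) pA"
  and linear_pV: "Vector_Spaces.linear (scl E) (scl V) pV"
  using vs by (simp_all add: Vector_Spaces.linear_iff proj_add proj_scale)

lemma twist_sum: "twist E (i a + j x) = i (twist A a) + j (twist V x)"
  using complement by (auto simp: contains_with_complement_def)

lemma twist_i: "twist E (i a) = i (twist A a)"
proof -
  have "twist V 0 = 0"
    using complement
    by (auto simp: contains_with_complement_def hom_vector_space_def linear_iff_module_hom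
        module_hom.zero)
  then show ?thesis using twist_sum[of a 0] by simp
qed

lemma pA_twist: "pA (twist E e) = twist A (pA e)"
  by (rule decompose[of e]) (simp add: twist_sum)

text \<open>After \<open>tmap_tmap\<close>, these turn every block of an embedded tensor into an
  identity or a zero map.\<close>

lemma proj_comp_incl [simp]:
  "pA \<circ> i = id" "pV \<circ> i = (\<lambda>_. 0)" "pA \<circ> j = (\<lambda>_. 0)" "pV \<circ> j = id"
  by auto

lemmas tmap_pA_pA = tmap_tmap[OF linear_pA linear_pA]

section \<open>Block decomposition of tensors over \<open>E\<close>\<close>

text \<open>Each functional on \<open>E\<close> is the sum of its parts factoring through
  \<open>pA\<close> and \<open>pV\<close>; biadditivity of \<open>t\<close> then yields the four
  blocks.\<close>

lemma tensor_decompose: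
  assumes t: "t \<in> tensor_space (scl E) (scl E)"
  shows "emb E i i (tmap (scl A) (scl A) pA pA t) + emb E j i (tmap (scl V) (scl A) pV pA t)
    + emb E i j (tmap (scl A) (scl V) pA pV t) + emb E j j (tmap (scl V) (scl V) pV pV t) = t"
    (is "?l = t")
proof (intro ext)
  fix f g
  show "?l f g = t f g"
  proof (cases "f \<in> dual (scl E) \<and> g \<in> dual (scl E)")
    case True
    have split: "h = (h \<circ> i \<circ> pA) + (h \<circ> j \<circ> pV)" if "h \<in> dual (scl E)" for h
    proof
      fix e
      have "h (i (pA e) + j (pV e)) = h (i (pA e)) + h (j (pV e))"
        using that by (simp add: dual_def Vector_Spaces.linear_iff)
      then show "h e = ((h \<circ> i \<circ> pA) + (h \<circ> j \<circ> pV)) e" by (simp add: sum_proj)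
    qed
    have mem: "h \<circ> i \<in> dual (scl A)" "h \<circ> j \<in> dual (scl V)"
        "h \<circ> i \<circ> pA \<in> dual (scl E)" "h \<circ> j \<circ> pV \<in> dual (scl E)" if "h \<in> dual (scl E)" for h
      using that by (auto intro!: dual_comp[of _ "scl A"] dual_comp[of _ "scl V"]
          dual_comp[of _ "scl E"] linear_i linear_j linear_pA linear_pV)
    have "t f g = t (f \<circ> i \<circ> pA) (g \<circ> i \<circ> pA) + t (f \<circ> j \<circ> pV) (g \<circ> i \<circ> pA)
        + t (f \<circ> i \<circ> pA) (g \<circ> j \<circ> pV) + t (f \<circ> j \<circ> pV) (g \<circ> j \<circ> pV)"
      using True mem split[of f] split[of g]
        tensor_space_add_left[OF t, of "f \<circ> i \<circ> pA" "f \<circ> j \<circ> pV"]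
        tensor_space_add_right[OF t, of "g \<circ> i \<circ> pA" "g \<circ> j \<circ> pV"]
      by (simp add: add.assoc)
    then show ?thesis using True mem by (simp add: tmap_def)
  qed (use tensor_space_outside[OF t] in \<open>auto simp: tmap_def\<close>)
qed

text \<open>Skew-symmetry makes the \<open>A\<close> \<otimes> \<open>V\<close> block minus the swap
  of the \<open>V\<close> \<otimes> \<open>A\<close> block, as in the cobracket of a unified
  product.\<close>

lemma skew_tensor_decompose:
  assumes t: "t \<in> tensor_space (scl E) (scl E)" and skew: "t = - tswap t"
  shows "emb E i i (tmap (scl A) (scl A) pA pA t) + emb E j i (tmap (scl V) (scl A) pV pA t)
    - emb E i j (tswap (tmap (scl V) (scl A) pV pA t))
    + emb E j j (tmap (scl V) (scl V) pV pV t) = t"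
proof -
  have "tswap t = - t" using arg_cong[OF skew, of uminus] by simp
  then have "tmap (scl A) (scl V) pA pV t = - tswap (tmap (scl V) (scl A) pV pA t)"
    by (simp add: tswap_tmap tmap_uminus)
  then show ?thesis
    using tensor_decompose[OF t] by (simp add: tmap_uminus)
qed

section \<open>Unified products are exactly the extensions\<close>

lemma cobrk_A_mem: "cobrk SA a \<in> tensor_space (scl A) (scl A)"
  using bialgebra_A
  by (auto simp: hom_lie_bialgebra_def hom_lie_coalgebra_def linear_to_tensor_def)

text \<open>The projection is a homomorphism: all cobracket terms other than that of
  \<open>A\<close> have a leg in \<open>V\<close>, which \<open>pA\<close> kills.\<close>

lemma unified1_in_bext:
  assumes D: "D \<in> LB1 E A SA V i j"
  shows "unified1 E SA i j D \<in> bext E A SA i j"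
proof -
  note lt = D[unfolded LB1_def, simplified]
  have mem: "phi1 D a \<in> tensor_space (scl V) (scl A)" "psi1 D x \<in> tensor_space (scl V) (scl A)"
    "P1 D a \<in> tensor_space (scl V) (scl V)" "cobrkV1 D x \<in> tensor_space (scl V) (scl V)" for a x
    using lt by (auto intro: linear_to_tensor_mem)
  \<comment> \<open>After the swap the leg in \<open>V\<close> is the right one, so these terms need
    \<open>tmap_zero_right\<close>.\<close>
  note sw = mem(1,2)[THEN tswap_in_tensor_space]
  have "hlb_hom E (unified1 E SA i j D) A SA pA"
    unfolding hlb_hom_def
    by (simp add: linear_pA pA_twist unified1_def Let_def tmap_add tmap_diff tmap_pA_pA
        tmap_id[OF cobrk_A_mem] tmap_zero_left[OF mem(1)] tmap_zero_left[OF mem(2)]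
        tmap_zero_left[OF mem(3)] tmap_zero_left[OF mem(4)]
        tmap_zero_right[OF sw(1)] tmap_zero_right[OF sw(2)])
  then show ?thesis using lt by (simp add: bext_def)
qed

text \<open>The inclusion is a homomorphism: elements of \<open>A\<close> have
  \<open>V\<close>-coordinate 0, so every map of the datum is evaluated at 0 and vanishes.\<close>

lemma unified2_in_bext:
  assumes D: "D \<in> LB2 E A SA V i j"
  shows "unified2 E SA i j D \<in> bext E A SA i j"
proof -
  note lt = D[unfolded LB2_def, simplified]
  have zero: "lact2 D 0 a = 0" "ract2 D 0 a = 0" "sigma2 D 0 0 = 0" "brkV2 D 0 0 = 0"
    "psi2 D 0 = 0" "Q2 D 0 = 0" "cobrkV2 D 0 = 0" for a
    using lt bilinear_map_zero_left[of _ _ _ "lact2 D"] bilinear_map_zero_left[of _ _ _ "ract2 D"]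
      bilinear_map_zero_left[of _ _ _ "sigma2 D"] bilinear_map_zero_left[of _ _ _ "brkV2 D"]
      linear_to_tensor_zero[of _ _ _ "psi2 D"] linear_to_tensor_zero[of _ _ _ "Q2 D"]
      linear_to_tensor_zero[of _ _ _ "cobrkV2 D"]
    by metis+
  have "hlb_hom A SA E (unified2 E SA i j D) i"
    unfolding hlb_hom_def
    by (simp add: linear_i twist_i unified2_def Let_def zero tmap_zero tswap_zero)
  then show ?thesis using lt by (simp add: bext_def)
qed

text \<open>The datum is read off from the components of \<open>S\<close>. Both types may yield the
  same \<open>S\<close>; existence is enough, since such data are identified by the
  equivalence.\<close>

lemma bext_subset_unified:
  assumes S: "S \<in> bext E A SA i j"
  shows "(\<exists>D \<in> LB1 E A SA V i j. unified1 E SA i j D = S) \<or>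
    (\<exists>D \<in> LB2 E A SA V i j. unified2 E SA i j D = S)"
proof -
  have HS: "hom_lie_bialgebra E S" using S by (simp add: bext_def)
  have bil: "bilinear_map (scl E) (scl E) (scl E) (brk S)"
    and skew: "brk S e e' = - brk S e' e"
    and co: "linear_to_tensor (scl E) (scl E) (scl E) (cobrk S)"
    and coskew: "cobrk S e = - tswap (cobrk S e)" for e e'
    using HS unfolding hom_lie_bialgebra_def hom_lie_algebra_def hom_lie_coalgebra_def by blast+
  have comem: "cobrk S e \<in> tensor_space (scl E) (scl E)" for e
    using co by (rule linear_to_tensor_mem)
  note codec = skew_tensor_decompose[OF comem coskew]
  have brk_add: "brk S (e + e') u = brk S e u + brk S e' u"
    "brk S u (e + e') = brk S u e + brk S u e'" for e e' u
    using bil by (auto simp: bilinear_map_def Vector_Spaces.linear_iff)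
  have co_add: "cobrk S (e + e') = cobrk S e + cobrk S e'" for e e'
    using co by (auto simp: linear_to_tensor_def Vector_Spaces.linear_iff)
  have proj_minus: "pA (- e) = - pA e" "pV (- e) = - pV e"
    "pA (e - e') = pA e - pA e'" "pV (e - e') = pV e - pV e'" for e e'
    using linear_pA linear_pV by (auto simp: linear_iff_module_hom module_hom.neg module_hom.diff)
  have brk_split: "brk S e e' = brk S (i (pA e)) (i (pA e')) + brk S (i (pA e)) (j (pV e'))
      + brk S (j (pV e)) (i (pA e')) + brk S (j (pV e)) (j (pV e'))" for e e'
    using brk_add(1)[of "i (pA e)" "j (pV e)" e'] brk_add(2)[of _ "i (pA e')" "j (pV e')"]
    by (simp add: sum_proj add.assoc)
  \<comment> \<open>Skew-symmetry turns the \<open>A\<close> \<times> \<open>V\<close> term into a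
    \<open>V\<close> \<times> \<open>A\<close> term, whence the minus sign in the unified bracket;
    likewise for \<open>pA_brk\<close>.\<close>
  have pV_brk: "pV (brk S e e') = pV (brk S (j (pV e)) (j (pV e'))) + pV (brk S (j (pV e)) (i (pA e')))
      - pV (brk S (j (pV e')) (i (pA e))) + pV (brk S (i (pA e)) (i (pA e')))" for e e'
    unfolding brk_split[of e e'] skew[of "i (pA e)" "j (pV e')"]
    by (simp add: proj_add proj_minus)
  have pA_brk: "pA (brk S e e') = pA (brk S (i (pA e)) (i (pA e'))) + pA (brk S (j (pV e)) (i (pA e')))
      - pA (brk S (j (pV e')) (i (pA e))) + pA (brk S (j (pV e)) (j (pV e')))" for e e'
    unfolding brk_split[of e e'] skew[of "i (pA e)" "j (pV e')"]
    by (simp add: proj_add proj_minus)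
  note bils = bilinear_map_comp[OF bil]
  note cos = linear_to_tensor_tmap[OF co]
  from S consider "hlb_hom E S A SA pA" | "hlb_hom A SA E S i" by (auto simp: bext_def)
  then show ?thesis
  proof cases
    case 1
    define D where "D = \<lparr>ract1 = \<lambda>x b. pV (brk S (j x) (i b)), theta1 = \<lambda>a b. pV (brk S (i a) (i b)),
      phi1 = \<lambda>a. tmap (scl V) (scl A) pV pA (cobrk S (i a)),
      psi1 = \<lambda>x. tmap (scl V) (scl A) pV pA (cobrk S (j x)),
      P1 = \<lambda>a. tmap (scl V) (scl V) pV pV (cobrk S (i a)),
      brkV1 = \<lambda>x y. pV (brk S (j x) (j y)),
      cobrkV1 = \<lambda>x. tmap (scl V) (scl V) pV pV (cobrk S (j x))\<rparr>"
    \<comment> \<open>These fix the \<open>A\<close>-component of the bracket and the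
      \<open>A\<close> \<otimes> \<open>A\<close> block of the cobracket on all of
      \<open>E\<close>.\<close>
    have b: "pA (brk S e e') = brk SA (pA e) (pA e')"
      and c: "tmap (scl A) (scl A) pA pA (cobrk S e) = cobrk SA (pA e)" for e e'
      using 1 by (auto simp: hlb_hom_def)
    \<comment> \<open>As \<open>pA\<close> kills \<open>V\<close>, the \<open>A\<close> \<otimes>
      \<open>A\<close> block of \<open>cobrk S (j x)\<close> is \<open>cobrk SA 0\<close>; its
      vanishing leaves no \<open>Q\<close>.\<close>
    have cA0: "cobrk SA 0 = 0"
      using bialgebra_A linear_to_tensor_zero
      unfolding hom_lie_bialgebra_def hom_lie_coalgebra_def by blast
    have "brk (unified1 E SA i j D) e e' = brk S e e'" for e e'
      using sum_proj[of "brk S e e'"] unfolding b pV_brk[of e e']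
      by (simp add: unified1_def D_def Let_def)
    moreover have "cobrk (unified1 E SA i j D) e = cobrk S e" for e
    proof -
      have "cobrk S e = cobrk S (i (pA e)) + cobrk S (j (pV e))"
        by (simp add: sum_proj flip: co_add)
      then show ?thesis
        using arg_cong2[of _ _ _ _ "(+)", OF codec[of "i (pA e)"] codec[of "j (pV e)"]]
        by (simp add: unified1_def D_def Let_def c cA0 tmap_zero algebra_simps)
    qed
    ultimately have U: "unified1 E SA i j D = S"
      by (auto intro!: hlb_struct.equality)
    \<comment> \<open>The bialgebra condition on the unified product holds because that product is
      \<open>S\<close>.\<close>
    have "D \<in> LB1 E A SA V i j"
      unfolding LB1_def using HS U
      by (auto simp: D_def intro!: bils cos linear_i linear_j linear_pA linear_pV)
    with U show ?thesis by blast
  next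
    case 2
    define D where "D = \<lparr>lact2 = \<lambda>x b. pA (brk S (j x) (i b)), ract2 = \<lambda>x b. pV (brk S (j x) (i b)),
      sigma2 = \<lambda>x y. pA (brk S (j x) (j y)),
      psi2 = \<lambda>x. tmap (scl V) (scl A) pV pA (cobrk S (j x)),
      Q2 = \<lambda>x. tmap (scl A) (scl A) pA pA (cobrk S (j x)),
      brkV2 = \<lambda>x y. pV (brk S (j x) (j y)),
      cobrkV2 = \<lambda>x. tmap (scl V) (scl V) pV pV (cobrk S (j x))\<rparr>"
    \<comment> \<open>On \<open>A\<close> neither the bracket nor the cobracket has a component in
      \<open>V\<close>, so there is no room for \<theta>, \<phi> or \<open>P\<close>.\<close>
    have b: "brk S (i a) (i b) = i (brk SA a b)"
      and c: "cobrk S (i a) = emb E i i (cobrk SA a)" for a b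
      using 2 by (auto simp: hlb_hom_def)
    have "brk (unified2 E SA i j D) e e' = brk S e e'" for e e'
      using sum_proj[of "brk S e e'"] unfolding pA_brk[of e e'] pV_brk[of e e']
      by (simp add: unified2_def D_def Let_def b)
    moreover have "cobrk (unified2 E SA i j D) e = cobrk S e" for e
    proof -
      have "cobrk S e = cobrk S (i (pA e)) + cobrk S (j (pV e))"
        by (simp add: sum_proj flip: co_add)
      then show ?thesis
        using codec[of "j (pV e)"]
        by (simp add: unified2_def D_def Let_def c algebra_simps)
    qed
    ultimately have U: "unified2 E SA i j D = S"
      by (auto intro!: hlb_struct.equality)
    have "D \<in> LB2 E A SA V i j"
      unfolding LB2_def using HS U
      by (auto simp: D_def intro!: bils cos linear_i linear_j linear_pA linear_pV)
    with U show ?thesis by blast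
  qed
qed

text \<open>One inclusion lets \<open>Upsilon\<close> land in \<open>BExtd\<close>, the other gives
  its surjectivity.\<close>

lemma unified_image_LB: "unified E SA i j ` LB E A SA V i j = bext E A SA i j"
proof
  show "unified E SA i j ` LB E A SA V i j \<subseteq> bext E A SA i j"
    using unified1_in_bext unified2_in_bext by (auto simp: LB_def unified_def)
  show "bext E A SA i j \<subseteq> unified E SA i j ` LB E A SA V i j"
  proof
    fix S assume "S \<in> bext E A SA i j"
    from bext_subset_unified[OF this] show "S \<in> unified E SA i j ` LB E A SA V i j"
      by (auto simp: LB_def unified_def intro: rev_image_eqI[OF InlI] rev_image_eqI[OF InrI])
  qed
qed

section \<open>Endomorphisms of \<open>E\<close> fixing \<open>A\<close>, and the comparison of the
  two equivalences\<close>

lemma fixes_A_iff_phi_rs: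
  assumes F: "Vector_Spaces.linear (scl E) (scl E) F"
  shows "(\<forall>a. F (i a) = i a) \<longleftrightarrow>
    (\<exists>r s. Vector_Spaces.linear (scl V) (scl A) r \<and> Vector_Spaces.linear (scl V) (scl V) s \<and>
      F = phi_rs i j r s)"
proof
  assume fix_A: "\<forall>a. F (i a) = i a"
  let ?r = "\<lambda>x. pA (F (j x))" and ?s = "\<lambda>x. pV (F (j x))"
  have "F e = phi_rs i j ?r ?s e" for e
  proof -
    have "F e = F (i (pA e)) + F (j (pV e))"
      using F sum_proj[of e] unfolding Vector_Spaces.linear_iff by metis
    then show ?thesis
      using fix_A sum_proj[of "F (j (pV e))"] by (simp add: phi_rs_def i_add add.assoc)
  qed
  moreover have "Vector_Spaces.linear (scl V) (scl A) ?r" "Vector_Spaces.linear (scl V) (scl V) ?s"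
    using F linear_j linear_pA linear_pV by (auto simp: Vector_Spaces.linear_iff)
  ultimately show "\<exists>r s. Vector_Spaces.linear (scl V) (scl A) r \<and>
      Vector_Spaces.linear (scl V) (scl V) s \<and> F = phi_rs i j r s"
    by blast
next
  assume "\<exists>r s. Vector_Spaces.linear (scl V) (scl A) r \<and>
      Vector_Spaces.linear (scl V) (scl V) s \<and> F = phi_rs i j r s"
  then obtain r s where r: "Vector_Spaces.linear (scl V) (scl A) r"
    and s: "Vector_Spaces.linear (scl V) (scl V) s" and "F = phi_rs i j r s"
    by blast
  \<comment> \<open>At \<open>i a\<close> the maps \<open>r\<close> and \<open>s\<close> are
    evaluated at the \<open>V\<close>-coordinate 0.\<close>
  moreover have "r 0 = 0" "s 0 = 0"
    using r s by (auto simp: linear_iff_module_hom module_hom.zero)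
  ultimately show "\<forall>a. F (i a) = i a" by (simp add: phi_rs_def)
qed

text \<open>Any isomorphism between the products is linear, so \<open>fixes_A_iff_phi_rs\<close>
  matches the two kinds of witnesses; bijectivity is part of \<open>hlb_iso\<close>.\<close>

lemma LB_equiv_eq_preimage:
  "LB_equiv E A SA V i j = {(D, D'). D \<in> LB E A SA V i j \<and> D' \<in> LB E A SA V i j \<and>
     (unified E SA i j D, unified E SA i j D') \<in> bext_equiv E A SA i j}"
proof -
  have "(\<exists>r s. Vector_Spaces.linear (scl V) (scl A) r \<and> Vector_Spaces.linear (scl V) (scl V) s \<and>
        hlb_iso E S E T (phi_rs i j r s)) \<longleftrightarrow>
      (\<exists>F. hlb_iso E S E T F \<and> (\<forall>a. F (i a) = i a))" for S T
  proof -
    have "Vector_Spaces.linear (scl E) (scl E) F" if "hlb_iso E S E T F" for F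
      using that by (simp add: hlb_iso_def hlb_hom_def)
    then show ?thesis using fixes_A_iff_phi_rs by metis
  qed
  then show ?thesis
    using unified_image_LB by (auto simp: LB_equiv_def bext_equiv_def)
qed

end

text \<open>\<open>Upsilon\<close> is a union over arbitrary sets of data; the clauses before
  bijectivity say that it is well defined on classes with the prescribed values.\<close>

theorem theorem5p17:
  fixes A :: "('k::alg_closed_field, 'a::ab_group_add) hom_vs"
    and SA :: "('k, 'a) hlb_struct"
    and E :: "('k, 'e::ab_group_add) hom_vs"
    and V :: "('k, 'v::ab_group_add) hom_vs"
    and i :: "'a \<Rightarrow> 'e" and j :: "'v \<Rightarrow> 'e"
  assumes "CHAR('k) \<noteq> 2" and "CHAR('k) \<noteq> 3"
    and "hom_lie_bialgebra A SA"
    and "contains_with_complement E A V i j"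
  shows "equiv (LB E A SA V i j) (LB_equiv E A SA V i j)
    \<and> equiv (bext E A SA i j) (bext_equiv E A SA i j)
    \<and> (\<forall>D \<in> LB1 E A SA V i j. Upsilon E A SA i j (LB_equiv E A SA V i j `` {Inl D})
         = bext_equiv E A SA i j `` {unified1 E SA i j D})
    \<and> (\<forall>D \<in> LB2 E A SA V i j. Upsilon E A SA i j (LB_equiv E A SA V i j `` {Inr D})
         = bext_equiv E A SA i j `` {unified2 E SA i j D})
    \<and> bij_betw (Upsilon E A SA i j) (HLB E A SA V i j) (BExtd E A SA i j)"
proof -
  interpret complemented A SA E V i j
    using assms by unfold_locales
  note Q = quotient_preimage_bij[OF equiv_bext_equiv unified_image_LB LB_equiv_eq_preimage]
  have U: "Upsilon E A SA i j = (\<lambda>c. \<Union>D\<in>c. bext_equiv E A SA i j `` {unified E SA i j D})"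
    by (simp add: Upsilon_def fun_eq_iff)
  have "Upsilon E A SA i j (LB_equiv E A SA V i j `` {D})
      = bext_equiv E A SA i j `` {unified E SA i j D}" if "D \<in> LB E A SA V i j" for D
    unfolding U using Q(2) that .
  \<comment> \<open>The two injections specialise \<open>unified\<close> to the products of type I
    and type II.\<close>
  from this[of "Inl _"] this[of "Inr _"] show ?thesis
    using Q(1) equiv_bext_equiv Q(3)
    by (simp add: LB_def HLB_def BExtd_def U unified_def InlI InrI)
qed

end
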